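(* Let $Y$ be a non-negative integer-valued random variable with probability generating function $G_Y(s)=\operatorname{E}(s^Y)$, let $n\ge 1$ be an integer, let $U=n[\frac{Y}{n}]$, and let $\omega=\exp(\frac{2\pi i}{n})$. Then the probability generating function $G_U(s)=\operatorname{E}(s^U)$ of $U$ is, for real $s$ with $|s|\le 1$, $$G_U(s)=\frac{s^n-1}{n\,s^{n/2-r}}\sum_{j=0}^{n-1}a(j)\,\frac{G_Y(s/\omega^{j})}{s-\omega^{j}},$$ where $$r=\begin{cases}1,& n\text{ even}\\ 1/2,& n\text{ odd}\end{cases}\qquad\text{and}\qquad a(j)=\begin{cases}(-1)^j,& n\text{ even}\\ (-1)^j\omega^{j/2},& n\text{ odd.}\end{cases}$$
   Context: For real $x$, $[x]$ denotes $x$ rounded to the nearest integer with the round-half-up tie-breaking rule, i.e. $[x]=\lfloor x+\tfrac12\rfloor$. Thus $U=n[\frac{Y}{n}]$ takes values in $\{0,n,2n,\ldots\}$. The probability generating function is $G_Y(s)=\sum_{y=0}^\infty P(Y=y)s^y$, which converges absolutely for all complex $s$ with $|s|\le 1$. Here $\omega^{j/2}$ means $\exp(\pi i j/n)$. At the values of $s$ where a denominator on the right-hand side vanishes ($s=0$, or $s=\omega^j$ for some $j$), the right-hand side is understood as its limit (the singularities are removable). *)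

theory Defs
  imports "HOL-Probability.Probability"
begin

definition pgf :: "'a measure \<Rightarrow> ('a \<Rightarrow> nat) \<Rightarrow> complex \<Rightarrow> complex" where
  "pgf M X z = (LINT x|M. z ^ X x)"

text \<open>On the closed unit disc the expectation is the absolutely convergent power series
  whose coefficients are the point probabilities.\<close>

lemma (in prob_space)
  fixes X :: "'a \<Rightarrow> nat" and z :: complex
  assumes X: "X \<in> measurable M (count_space UNIV)" and z: "norm z \<le> 1"
  shows pgf_abs_summable:
      "summable (\<lambda>k. norm (of_real (prob {x \<in> space M. X x = k}) * z ^ k))" (is ?summable)
    and pgf_sums: "(\<lambda>k. of_real (prob {x \<in> space M. X x = k}) * z ^ k) sums pgf M X z" (is ?sums)
proof -
  let ?A = "\<lambda>k. {x \<in> space M. X x = k}"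
  let ?f = "\<lambda>k x. indicator (?A k) x *\<^sub>R z ^ k"
  have meas [measurable]: "?A k \<in> sets M" for k
    using X by measurable
  have "(\<lambda>k. prob (?A k)) sums prob (\<Union>k. ?A k)"
    by (rule measure_UNION) (auto simp: disjoint_family_on_def emeasure_eq_measure)
  then have summ: "summable (\<lambda>k. prob (?A k))"
    by (rule sums_summable)
  show s: ?summable
  proof (rule summable_comparison_test'[OF summ, of 0])
    fix k
    show "norm (norm (of_real (prob (?A k)) * z ^ k)) \<le> prob (?A k)"
      using z by (simp add: norm_mult norm_power mult_left_le power_le_one)
  qed
  have cap: "?A k \<inter> space M = ?A k" for k
    by auto
  have int: "integrable M (?f k)" for k
    by (intro integrable_scaleR_left) (auto simp: emeasure_eq_measure)
  have f_supp: "?f k x = 0" if "k \<notin> {X x}" for k x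
    using that by auto
  have val: "(\<Sum>k. ?f k x) = z ^ X x" if "x \<in> space M" for x
    using that by (subst suminf_finite[of "{X x}"]) auto
  have nrm: "(LINT x|M. norm (?f k x)) = norm (of_real (prob (?A k)) * z ^ k)" for k
  proof -
    have "(LINT x|M. norm (?f k x)) = (LINT x|M. indicator (?A k) x * norm (z ^ k))"
      by simp
    also have "\<dots> = prob (?A k) * norm (z ^ k)"
      by (simp add: cap)
    finally show ?thesis
      by (simp add: norm_mult)
  qed
  have "(\<lambda>k. integral\<^sup>L M (?f k)) sums (LINT x|M. (\<Sum>k. ?f k x))"
  proof (rule sums_integral[OF int])
    show "AE x in M. summable (\<lambda>k. norm (?f k x))"
    proof (rule AE_I2)
      fix x
      show "summable (\<lambda>k. norm (?f k x))"
        by (rule summable_finite[of "{X x}"]) (auto simp: f_supp)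
    qed
    show "summable (\<lambda>k. LINT x|M. norm (?f k x))"
      using s by (simp only: nrm)
  qed
  moreover have "integral\<^sup>L M (?f k) = of_real (prob (?A k)) * z ^ k" for k
    by (simp add: scaleR_conv_of_real cap)
  moreover have "(LINT x|M. (\<Sum>k. ?f k x)) = pgf M X z"
    unfolding pgf_def by (rule Bochner_Integration.integral_cong) (auto simp: val)
  ultimately show ?sums
    by simp
qed

definition omega :: "nat \<Rightarrow> complex" where
  "omega n = exp (2 * of_real pi * \<i> / of_nat n)"

definition r_const :: "nat \<Rightarrow> real" where
  "r_const n = (if even n then 1 else 1 / 2)"

text \<open>For odd \<open>n\<close>, the branch of \<open>\<omega>\<^sup>j\<^sup>/\<^sup>2\<close> is the one with value \<open>exp (\<pi> \<i> j / n)\<close>.\<close>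

definition a_coeff :: "nat \<Rightarrow> nat \<Rightarrow> complex" where
  "a_coeff n j = (if even n then (-1) ^ j
                  else (-1) ^ j * exp (of_real pi * \<i> * of_nat j / of_nat n))"

text \<open>The exponent \<open>n/2 - r\<close> is a natural number, so that the power of a negative base is
  unambiguous; neither \<open>nat\<close> nor the floor below loses anything.\<close>

definition half_exponent :: "nat \<Rightarrow> nat" where
  "half_exponent n = nat \<lfloor>real n / 2 - r_const n\<rfloor>"

lemma real_half_exponent:
  assumes "n \<ge> 1"
  shows "real (half_exponent n) = real n / 2 - r_const n"
proof (cases "even n")
  case True
  then obtain k where k: "n = 2 * k" by (elim evenE)
  with assms have "real n / 2 - r_const n = of_int (int k - 1)" "k \<ge> 1"
    by (auto simp: r_const_def)
  then show ?thesis unfolding half_exponent_def by (simp only: floor_of_int)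
next
  case False
  then obtain k where k: "n = 2 * k + 1" by (elim oddE)
  then have "real n / 2 - r_const n = of_int (int k)"
    by (simp add: r_const_def field_simps)
  then show ?thesis unfolding half_exponent_def by (simp only: floor_of_int)
qed

definition rounding_formula :: "nat \<Rightarrow> (complex \<Rightarrow> complex) \<Rightarrow> complex \<Rightarrow> complex" where
  "rounding_formula n G z =
     (z ^ n - 1) / (of_nat n * z ^ half_exponent n) *
     (\<Sum>j<n. a_coeff n j * (G (z / omega n ^ j) / (z - omega n ^ j)))"

end

theory Submission
  imports Defs
begin

text \<open>
  Put \<open>h = n/2 - r\<close>. Since \<open>-1 = \<omega>\<^bsup>n/2\<^esup>\<close>, both parity cases of \<open>a(j)\<close> are the single
  expression \<open>w\<^bsup>h+1\<^esup>\<close> with \<open>w = \<omega>\<^sup>j\<close> (\<open>a_coeff_eq\<close>). The formula is linear in the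
  distribution of \<open>Y\<close>, so it suffices to treat a constant \<open>Y = k\<close>, where \<open>G\<^sub>Y(s) = s\<^sup>k\<close> and the
  claim reads \<open>(s\<^sup>n - 1) (\<Sum>w. w\<^bsup>h+1\<^esup> (s/w)\<^sup>k / (s - w)) = n s\<^bsup>h+N\<^esup>\<close> with \<open>N = n [k/n]\<close>.

  Here the rounding enters through one fact: \<open>N\<close> is the multiple of \<open>n\<close> for which
  \<open>c = h + N - k\<close> lies in \<open>{0..<n}\<close> (\<open>round_to_multiple\<close>). As \<open>w\<^sup>N = 1\<close>, the factor
  \<open>w\<^bsup>h+1\<^esup> / w\<^sup>k\<close> equals \<open>w\<^bsup>c+1\<^esup>\<close>, and the claim becomes the partial fraction expansion of
  \<open>n s\<^sup>c / (s\<^sup>n - 1)\<close> over the \<open>n\<close>-th roots of unity (\<open>roots_of_unity_partial_fractions\<close>).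

  Taking expectations gives the formula wherever its denominators do not vanish. In \<open>[-1,1]\<close> the
  exceptional points lie among \<open>0, 1, -1\<close>, so they are isolated, and the limits there follow
  from the continuity of \<open>G\<^sub>U\<close> on the closed disc (\<open>continuous_on_pgf\<close>).
\<close>

section \<open>Sums over roots of unity\<close>

lemma omega_power: "omega n ^ d = exp (2 * of_real pi * \<i> * of_nat d / of_nat n)"
  by (simp add: omega_def exp_of_nat_mult[symmetric] mult_ac)

lemma omega_nonzero [simp]: "omega n \<noteq> 0"
  by (simp add: omega_def)

lemma omega_power_eq_1_iff:
  assumes "n \<ge> 1"
  shows "omega n ^ d = 1 \<longleftrightarrow> n dvd d"
  using complex_root_unity_eq_1[OF assms, of d] by (simp add: omega_power)

lemma norm_omega [simp]: "norm (omega n) = 1"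
proof -
  have "omega n = exp (\<i> * of_real (2 * pi / real n))"
    by (simp add: omega_def mult_ac)
  then show ?thesis
    by (simp only: norm_exp_i_times)
qed

lemma sum_powers_roots_of_unity:
  assumes "n \<ge> 1"
  shows "(\<Sum>j<n. (omega n ^ j) ^ d) = (if n dvd d then of_nat n else 0)"
proof -
  have flip: "(omega n ^ j) ^ d = (omega n ^ d) ^ j" for j
    by (simp add: power_mult[symmetric] mult.commute)
  show ?thesis
  proof (cases "n dvd d")
    case True
    then show ?thesis
      using omega_power_eq_1_iff[OF assms, of d] by (simp add: flip)
  next
    case False
    then have "omega n ^ d \<noteq> 1"
      using omega_power_eq_1_iff[OF assms] by blast
    moreover have "(omega n ^ d) ^ n = 1"
      using omega_power_eq_1_iff[OF assms, of "d * n"] by (simp add: power_mult)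
    ultimately show ?thesis
      using False by (simp add: flip geometric_sum)
  qed
qed

text \<open>Expand \<open>(z\<^sup>n - 1)/(z - w) = (\<Sum>m<n. w\<^bsup>n-1-m\<^esup> z\<^sup>m)\<close> for each root \<open>w\<close>; summation over the
  roots then extracts the coefficient with \<open>m = c\<close>.\<close>

lemma roots_of_unity_partial_fractions:
  fixes z :: complex
  assumes n: "n \<ge> 1" and c: "c < n" and z: "\<And>j. j < n \<Longrightarrow> z \<noteq> omega n ^ j"
  shows "(z ^ n - 1) * (\<Sum>j<n. (omega n ^ j) ^ Suc c / (z - omega n ^ j)) = of_nat n * z ^ c"
proof -
  have summand: "(z ^ n - 1) * ((omega n ^ j) ^ Suc c / (z - omega n ^ j)) =
      (\<Sum>m<n. (omega n ^ j) ^ (n + c - m) * z ^ m)" if j: "j < n" for j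
  proof -
    let ?w = "omega n ^ j"
    have "?w ^ n = 1"
      using omega_power_eq_1_iff[OF n, of "j * n"] by (simp add: power_mult)
    then have "z ^ n - 1 = (z - ?w) * (\<Sum>m<n. ?w ^ (n - Suc m) * z ^ m)"
      using power_diff_sumr2[of z n ?w] by simp
    then have "(z ^ n - 1) * (?w ^ Suc c / (z - ?w)) =
        ?w ^ Suc c * (\<Sum>m<n. ?w ^ (n - Suc m) * z ^ m)"
      using z[OF j] by simp
    also have "\<dots> = (\<Sum>m<n. ?w ^ (Suc c + (n - Suc m)) * z ^ m)"
      unfolding sum_distrib_left power_add by (simp only: mult.assoc)
    also have "\<dots> = (\<Sum>m<n. ?w ^ (n + c - m) * z ^ m)"
    proof (rule sum.cong[OF refl])
      fix m assume "m \<in> {..<n}"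
      then have "Suc c + (n - Suc m) = n + c - m" by auto
      then show "?w ^ (Suc c + (n - Suc m)) * z ^ m = ?w ^ (n + c - m) * z ^ m"
        by (simp only:)
    qed
    finally show ?thesis .
  qed
  have "(z ^ n - 1) * (\<Sum>j<n. (omega n ^ j) ^ Suc c / (z - omega n ^ j)) =
      (\<Sum>j<n. \<Sum>m<n. (omega n ^ j) ^ (n + c - m) * z ^ m)"
    unfolding sum_distrib_left by (intro sum.cong refl summand) simp
  also have "\<dots> = (\<Sum>m<n. (\<Sum>j<n. (omega n ^ j) ^ (n + c - m)) * z ^ m)"
    by (subst sum.swap) (simp add: sum_distrib_right)
  also have "\<dots> = (\<Sum>m<n. if m = c then of_nat n * z ^ m else 0)"
  proof (rule sum.cong[OF refl])
    fix m assume "m \<in> {..<n}"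
    (* The exponent lies strictly between 0 and 2 n, so n is the only multiple it can be. *)
    have "n dvd n + c - m \<longleftrightarrow> m = c"
    proof
      assume "n dvd n + c - m"
      then obtain q where q: "n + c - m = n * q" by blast
      have "0 < n + c - m" "n + c - m < n * 2"
        using c \<open>m \<in> {..<n}\<close> by auto
      then have "0 < n * q" "n * q < n * 2"
        unfolding q .
      then have "q = 1" by auto
      with q c show "m = c" by auto
    qed auto
    then show "(\<Sum>j<n. (omega n ^ j) ^ (n + c - m)) * z ^ m = (if m = c then of_nat n * z ^ m else 0)"
      by (simp add: sum_powers_roots_of_unity[OF n])
  qed
  also have "\<dots> = of_nat n * z ^ c"
    using c by simp
  finally show ?thesis .
qed

section \<open>The coefficients and the rounding\<close>

lemma n_eq_half_exponent:
  assumes "n \<ge> 1"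
  shows "n = 2 * half_exponent n + (if even n then 2 else 1)"
proof -
  have "real n = real (2 * half_exponent n + (if even n then 2 else 1))"
    using real_half_exponent[OF assms] by (simp add: r_const_def)
  then show ?thesis
    by (simp only: of_nat_eq_iff)
qed

text \<open>For even \<open>n\<close> use \<open>-1 = \<omega>\<^bsup>n/2\<^esup>\<close> and \<open>h + 1 = n/2\<close>; for odd \<open>n\<close> the half power
  \<open>\<omega>\<^bsup>j/2\<^esup>\<close> completes \<open>(-1)\<^sup>j\<close> to \<open>\<omega>\<^bsup>j(n+1)/2\<^esup>\<close>, where \<open>h + 1 = (n+1)/2\<close>.\<close>

lemma a_coeff_eq:
  assumes n: "n \<ge> 1"
  shows "a_coeff n j = (omega n ^ j) ^ Suc (half_exponent n)"
proof -
  have minus1: "(-1) ^ j = exp (of_real pi * \<i> * of_nat j)"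
    by (metis exp_of_nat2_mult exp_pi_i)
  have rhs: "(omega n ^ j) ^ Suc (half_exponent n) =
      exp (2 * of_real pi * \<i> * of_nat (j * Suc (half_exponent n)) / of_nat n)"
    by (simp only: power_mult[symmetric] omega_power[of n "j * Suc (half_exponent n)"])
  have expo: "2 * of_real pi * \<i> * of_nat (j * Suc (half_exponent n)) / of_nat n =
      of_real pi * \<i> * of_nat j * (2 * of_nat (Suc (half_exponent n))) / of_nat n"
    by (simp add: algebra_simps)
  have n0: "of_nat n \<noteq> (0 :: complex)"
    using n by simp
  have n_eq: "of_nat n = (2 * of_nat (half_exponent n) + (if even n then 2 else 1) :: complex)"
    using arg_cong[OF n_eq_half_exponent[OF n], of "of_nat :: nat \<Rightarrow> complex"] by simp
  show ?thesis
  proof (cases "even n")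
    case True
    then have two: "2 * of_nat (Suc (half_exponent n)) = (of_nat n :: complex)"
      using n_eq by simp
    have "2 * of_real pi * \<i> * of_nat (j * Suc (half_exponent n)) / of_nat n =
        of_real pi * \<i> * of_nat j"
      unfolding expo two using n0 by (rule nonzero_mult_div_cancel_right)
    then show ?thesis
      using True by (simp only: rhs a_coeff_def minus1 if_True)
  next
    case False
    then have two: "2 * of_nat (Suc (half_exponent n)) = (of_nat n + 1 :: complex)"
      using n_eq by simp
    have "2 * of_real pi * \<i> * of_nat (j * Suc (half_exponent n)) / of_nat n =
        of_real pi * \<i> * of_nat j + of_real pi * \<i> * of_nat j / of_nat n"
      unfolding expo two using n0 by (simp add: field_simps)
    then show ?thesis
      using False by (simp only: rhs a_coeff_def minus1 if_False exp_add)
  qed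
qed

text \<open>The exponent \<open>h\<close> is the largest amount by which rounding half up can decrease \<open>k\<close>: a tie
  at even \<open>n\<close> goes up, hence the \<open>1\<close> subtracted from \<open>n/2\<close> there. The largest increase is
  \<open>n - 1 - h\<close>, which accounts for the other \<open>n - 1 - h\<close> residues.\<close>

lemma round_to_multiple:
  fixes n k :: nat
  assumes n: "n \<ge> 1"
  defines "N \<equiv> n * nat (round (real k / real n))"
  shows "k \<le> half_exponent n + N" and "half_exponent n + N - k < n"
proof -
  define q where "q = round (real k / real n)"
  have q0: "q \<ge> 0"
    unfolding q_def round_def by (simp add: le_floor_iff)
  have rN: "real N = real n * of_int q"
    unfolding N_def q_def[symmetric] using q0 by simp
  have pos: "real n > 0"
    using n by simp
  have "of_int q \<le> real k / real n + 1/2" "real k / real n + 1/2 < of_int q + 1"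
    unfolding q_def round_def by linarith+
  then have "real N \<le> real k + real n / 2" "real k + real n / 2 < real N + real n"
    using pos by (simp_all add: rN field_simps)
  then have "2 * N \<le> 2 * k + n" "2 * k < 2 * N + n"
    by linarith+
  moreover obtain b where "n = 2 * half_exponent n + b" "b = 2 \<and> even n \<or> b = 1"
    using n_eq_half_exponent[OF n] by (metis (full_types))
  ultimately show "k \<le> half_exponent n + N" "half_exponent n + N - k < n"
    by presburger+
qed

text \<open>The case of a constant \<open>Y = k\<close>.\<close>

lemma rounding_formula_power:
  fixes z :: complex
  assumes n: "n \<ge> 1" and z0: "z ^ half_exponent n \<noteq> 0"
    and z: "\<And>j. j < n \<Longrightarrow> z \<noteq> omega n ^ j"
  shows "rounding_formula n (\<lambda>w. w ^ k) z = z ^ (n * nat (round (real k / real n)))"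
proof -
  define N where "N = n * nat (round (real k / real n))"
  define c where "c = half_exponent n + N - k"
  have kc: "k + c = half_exponent n + N" and c: "c < n"
    using round_to_multiple[OF n, of k] unfolding c_def N_def by linarith+
  have summand: "a_coeff n j * ((z / omega n ^ j) ^ k / (z - omega n ^ j)) =
      z ^ k * ((omega n ^ j) ^ Suc c / (z - omega n ^ j))" for j
  proof -
    let ?w = "omega n ^ j"
    have "?w ^ N = 1"
      unfolding N_def power_mult[symmetric] omega_power_eq_1_iff[OF n] by simp
    then have "?w ^ Suc (half_exponent n) = ?w ^ (Suc (half_exponent n) + N)"
      by (simp only: power_add mult_1_right)
    also have "\<dots> = ?w ^ k * ?w ^ Suc c"
      using kc by (simp only: power_add[symmetric] add_Suc add_Suc_right)
    finally have "a_coeff n j = ?w ^ k * ?w ^ Suc c"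
      by (simp only: a_coeff_eq[OF n])
    then show ?thesis
      by (simp add: power_divide del: power_Suc)
  qed
  have "rounding_formula n (\<lambda>w. w ^ k) z = (z ^ n - 1) / (of_nat n * z ^ half_exponent n) *
      (z ^ k * (\<Sum>j<n. (omega n ^ j) ^ Suc c / (z - omega n ^ j)))"
    unfolding rounding_formula_def summand sum_distrib_left ..
  also have "\<dots> = z ^ k * ((z ^ n - 1) * (\<Sum>j<n. (omega n ^ j) ^ Suc c / (z - omega n ^ j))) /
      (of_nat n * z ^ half_exponent n)"
    by simp
  also have "\<dots> = z ^ k * (of_nat n * z ^ c) / (of_nat n * z ^ half_exponent n)"
    using roots_of_unity_partial_fractions[OF n c z] by simp
  also have "\<dots> = z ^ (k + c) / z ^ half_exponent n"
    using n by (simp add: power_add)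
  also have "\<dots> = z ^ N"
    using z0 by (simp add: kc power_add)
  finally show ?thesis
    unfolding N_def .
qed

section \<open>Generating functions\<close>

lemma (in prob_space) integrable_power:
  fixes z :: complex
  assumes "X \<in> measurable M (count_space UNIV)" and "norm z \<le> 1"
  shows "integrable M (\<lambda>x. z ^ X x)"
proof (rule integrable_const_bound[of _ 1])
  show "AE x in M. norm (z ^ X x) \<le> 1"
    using assms(2) by (simp add: norm_power power_le_one)
  show "(\<lambda>x. z ^ X x) \<in> borel_measurable M"
    using assms(1) by measurable
qed

lemma (in prob_space) continuous_on_pgf:
  assumes X [measurable]: "X \<in> measurable M (count_space UNIV)"
  shows "continuous_on (cball 0 1) (pgf M X)"
  unfolding continuous_on_sequentially comp_def pgf_def
proof (intro allI ballI impI, elim conjE)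
  fix z :: "nat \<Rightarrow> complex" and l
  assume l: "l \<in> cball 0 1" and z: "\<forall>i. z i \<in> cball 0 1" and lim: "z \<longlonglongrightarrow> l"
  show "(\<lambda>i. LINT x|M. z i ^ X x) \<longlonglongrightarrow> (LINT x|M. l ^ X x)"
  proof (rule integral_dominated_convergence[where w = "\<lambda>_. 1"])
    show "AE x in M. (\<lambda>i. z i ^ X x) \<longlonglongrightarrow> l ^ X x"
      using lim by (intro AE_I2 tendsto_power)
    show "AE x in M. norm (z i ^ X x) \<le> 1" for i
      using z by (simp add: norm_power power_le_one)
  qed simp_all
qed

lemma (in prob_space) pgf_round_to_multiple:
  fixes z :: complex
  assumes Y: "Y \<in> measurable M (count_space UNIV)" and n: "n \<ge> 1" and norm: "norm z \<le> 1"
    and z0: "z ^ half_exponent n \<noteq> 0" and z: "\<And>j. j < n \<Longrightarrow> z \<noteq> omega n ^ j"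
  shows "rounding_formula n (pgf M Y) z = pgf M (\<lambda>x. n * nat (round (real (Y x) / real n))) z"
proof -
  have int: "integrable M (\<lambda>x. (z / omega n ^ j) ^ Y x)" for j
    using norm by (intro integrable_power[OF Y]) (simp add: norm_divide norm_power)
  have "(\<Sum>j<n. a_coeff n j * (pgf M Y (z / omega n ^ j) / (z - omega n ^ j))) =
      (LINT x|M. (\<Sum>j<n. a_coeff n j * ((z / omega n ^ j) ^ Y x / (z - omega n ^ j))))"
    unfolding pgf_def using int by (subst Bochner_Integration.integral_sum) auto
  then have "rounding_formula n (pgf M Y) z = (LINT x|M. rounding_formula n (\<lambda>w. w ^ Y x) z)"
    unfolding rounding_formula_def by simp
  then show ?thesis
    by (simp add: pgf_def rounding_formula_power[OF n z0 z])
qed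

theorem theorem1:
  fixes M :: "'a measure" and Y U :: "'a \<Rightarrow> nat" and n :: nat and s :: real
  assumes "prob_space M"
    and "Y \<in> measurable M (count_space UNIV)"
    and "n \<ge> 1"
    and "U = (\<lambda>x. n * nat (round (real (Y x) / real n)))"
    and "\<bar>s\<bar> \<le> 1"
  shows "((of_nat n * complex_of_real s ^ half_exponent n \<noteq> 0 \<and>
           (\<forall>j<n. complex_of_real s - omega n ^ j \<noteq> 0)) \<longrightarrow>
           pgf M U (of_real s) = rounding_formula n (pgf M Y) (of_real s)) \<and>
         ((s = 0 \<or> (\<exists>j<n. complex_of_real s = omega n ^ j)) \<longrightarrow>
           ((\<lambda>t::real. rounding_formula n (pgf M Y) (of_real t)) \<longlongrightarrow> pgf M U (of_real s))
             (at s within {-1..1}))"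
proof -
  interpret prob_space M by fact
  have eq: "rounding_formula n (pgf M Y) (of_real t) = pgf M U (of_real t)"
    if "\<bar>t\<bar> \<le> 1" "complex_of_real t ^ half_exponent n \<noteq> 0"
      "\<And>j. j < n \<Longrightarrow> complex_of_real t \<noteq> omega n ^ j" for t :: real
    unfolding assms(4) using that
    by (intro pgf_round_to_multiple[OF assms(2,3)]) auto
  have U: "U \<in> measurable M (count_space UNIV)"
    using measurable_compose[OF assms(2), of "\<lambda>k. n * nat (round (real k / real n))"]
    by (simp add: assms(4))
  have "continuous_on {-1..1} (\<lambda>t::real. pgf M U (of_real t))"
    by (rule continuous_on_compose2[OF continuous_on_pgf[OF U]]) (auto intro!: continuous_intros)
  then have lim: "((\<lambda>t::real. pgf M U (of_real t)) \<longlongrightarrow> pgf M U (of_real s)) (at s within {-1..1})"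
    unfolding continuous_on_def using assms(5) by (auto simp: abs_le_iff)
  have "open (- ({0, 1, -1} - {s}))"
    by (intro open_Compl finite_imp_closed) simp
  then have "eventually (\<lambda>t. t \<in> - ({0, 1, -1} - {s})) (nhds s)"
    by (rule eventually_nhds_in_open) simp
  then have "eventually (\<lambda>t. rounding_formula n (pgf M Y) (of_real t) = pgf M U (of_real t))
      (at s within {-1..1})"
    unfolding eventually_at_filter
  proof eventually_elim
    case (elim t)
    show ?case
    proof (intro impI eq)
      assume t: "t \<noteq> s" "t \<in> {-1..1}"
      with elim have t0: "t \<noteq> 0" and t1: "\<bar>t\<bar> \<noteq> 1"
        by auto
      show "\<bar>t\<bar> \<le> 1" "complex_of_real t ^ half_exponent n \<noteq> 0"
        using t t0 by auto
      show "complex_of_real t \<noteq> omega n ^ j" for j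
      proof
        assume "complex_of_real t = omega n ^ j"
        then have "norm (complex_of_real t) = 1"
          by (simp add: norm_power)
        with t1 show False
          by simp
      qed
    qed
  qed
  then have "((\<lambda>t::real. rounding_formula n (pgf M Y) (of_real t)) \<longlongrightarrow> pgf M U (of_real s))
      (at s within {-1..1})"
    using lim by (simp cong: tendsto_cong)
  moreover have "pgf M U (of_real s) = rounding_formula n (pgf M Y) (of_real s)"
    if "of_nat n * complex_of_real s ^ half_exponent n \<noteq> 0 \<and>
      (\<forall>j<n. complex_of_real s - omega n ^ j \<noteq> 0)"
    using that assms(5) by (intro eq[symmetric]) auto
  ultimately show ?thesis
    by blast
qed

end
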